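(* Let $(Z_t)$ be a continuous-time Markov chain on a finite state space $\Sigma$, let $\Sigma_0 \subset \Sigma$ be a fixed subset, let $T := \inf\{t : Z_t \in \Sigma_0\}$, and assume that $h(S) := \mathbb{E}_S T < \infty$ for each $S \in \Sigma$. Assume also the monotonicity condition that $h(S') \le h(S)$ whenever $S \to S'$ is a possible transition. Then, for any initial state not in $\Sigma_0$, \[ \frac{\mathrm{var}\, T}{\mathbb{E} T} \le \max\{ h(S) - h(S') : S \to S' \text{ a possible transition} \}. \]
   Context: $\mathbb{E}_S$ denotes expectation for the chain started at state $S$. A transition $S \to S'$ (with $S \ne S'$) is possible if its transition rate $q(S,S')$ is strictly positive. $\mathrm{var}\,T$ and $\mathbb{E}T$ refer to the chain started at the given initial state. *)

theory Defs
  imports "HOL-Probability.Probability"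
begin

text \<open>
  A time-homogeneous continuous-time Markov chain on the finite state space \<open>UNIV :: 's set\<close>, given
  by the laws \<open>P S\<close> of the process \<open>Z\<close> started at \<open>S\<close>. The transition function is
  \<open>p\<^sub>t(S, S') = P S (Z\<^sub>t = S')\<close>, and the Markov property is stated for all finite
  sets of past times. Paths are right-continuous for the discrete topology on states, i.e. after
  any time the path stays constant for a positive while. The rates \<open>q S S'\<close> are meaningful only for
  \<open>S \<noteq> S'\<close>; the diagonal of \<open>q\<close> is left unconstrained and is never used.
\<close>

locale finite_ctmc =
  fixes P :: "'s::finite \<Rightarrow> 'w measure"
    and Z :: "real \<Rightarrow> 'w \<Rightarrow> 's"
    and q :: "'s \<Rightarrow> 's \<Rightarrow> real"
  assumes prob_space_law: "prob_space (P S)"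
    and measurable_state: "0 \<le> t \<Longrightarrow> Z t \<in> measurable (P S) (count_space UNIV)"
    and right_continuous_paths:
      "\<omega> \<in> space (P S) \<Longrightarrow> 0 \<le> t \<Longrightarrow> eventually (\<lambda>u. Z u \<omega> = Z t \<omega>) (at_right t)"
    and initial_state: "\<P>(\<omega> in P S. Z 0 \<omega> = S) = 1"
    and markov:
      "finite J \<Longrightarrow> J \<subseteq> {0..s} \<Longrightarrow> 0 \<le> s \<Longrightarrow> 0 \<le> t \<Longrightarrow>
       \<P>(\<omega> in P S. Z s \<omega> = S' \<and> (\<forall>u\<in>J. Z u \<omega> = f u)) > 0 \<Longrightarrow>
       \<P>(\<omega> in P S. Z (s + t) \<omega> = S'' \<bar> Z s \<omega> = S' \<and> (\<forall>u\<in>J. Z u \<omega> = f u))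
         = \<P>(\<omega> in P S'. Z t \<omega> = S'')"
    and transition_rate:
      "S \<noteq> S' \<Longrightarrow> ((\<lambda>t. \<P>(\<omega> in P S. Z t \<omega> = S') / t) \<longlongrightarrow> q S S') (at_right 0)"

definition possible_transition :: "('s \<Rightarrow> 's \<Rightarrow> real) \<Rightarrow> 's \<Rightarrow> 's \<Rightarrow> bool" where
  "possible_transition q S S' \<longleftrightarrow> S \<noteq> S' \<and> q S S' > 0"

text \<open>The infimum is taken in \<^typ>\<open>ennreal\<close>, so that it is \<open>\<infinity>\<close> on paths never visiting \<open>A\<close>.\<close>

definition hitting_time :: "(real \<Rightarrow> 'w \<Rightarrow> 's) \<Rightarrow> 's set \<Rightarrow> 'w \<Rightarrow> ennreal" where
  "hitting_time Z A \<omega> = (INF t\<in>{t. 0 \<le> t \<and> Z t \<omega> \<in> A}. ennreal t)"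

definition mean_hitting_time ::
    "('s \<Rightarrow> 'w measure) \<Rightarrow> (real \<Rightarrow> 'w \<Rightarrow> 's) \<Rightarrow> 's set \<Rightarrow> 's \<Rightarrow> ennreal" where
  "mean_hitting_time P Z A S = (\<integral>\<^sup>+ \<omega>. hitting_time Z A \<omega> \<partial>P S)"

text \<open>
  The real-valued version, sending \<open>\<infinity>\<close> to \<open>0\<close>. It is used only when the mean hitting time is
  finite, in which case it agrees almost surely with \<^const>\<open>hitting_time\<close>.
\<close>

definition real_hitting_time :: "(real \<Rightarrow> 'w \<Rightarrow> 's) \<Rightarrow> 's set \<Rightarrow> 'w \<Rightarrow> real" where
  "real_hitting_time Z A \<omega> = enn2real (hitting_time Z A \<omega>)"

end

theory Submission imports Defs "HOL-Real_Asymp.Real_Asymp" begin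

text \<open>
  Let \<open>L\<close> be the generator. The Markov property over a short time \<open>\<epsilon>\<close> gives \<open>L h \<le> -1\<close> off the target;
  only this inequality is needed. If every possible transition decreases \<open>h\<close> by at most \<open>\<delta> \<ge> 0\<close>, then
  \<open>(h S - h S')\<^sup>2 \<le> \<delta> (h S - h S')\<close>, so \<open>L (h\<^sup>2 + \<delta> h) \<le> 2 h L h \<le> - 2 h\<close>. Hence \<open>h\<^sup>2 + \<delta> h\<close> is a
  supersolution of the equation solved by the second moment of \<open>T\<close>, which yields
  \<open>E T\<^sup>2 \<le> h\<^sup>2 + \<delta> h\<close>, i.e. \<open>var T \<le> \<delta> h\<close>. The comparison is done for the chain observed on a
  grid of small mesh \<open>s\<close>: the grid hitting time dominates \<open>T\<close>, and involves only
  finite-dimensional distributions.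
\<close>

section \<open>Transition probabilities and the Markov property\<close>

context finite_ctmc
begin

sublocale law: prob_space "P S" for S
  by (rule prob_space_law)

lemma Z_measurable [measurable (raw)]: "0 \<le> t \<Longrightarrow> Z t \<in> measurable (P S) (count_space UNIV)"
  by (rule measurable_state)

definition trans_prob :: "real \<Rightarrow> 's \<Rightarrow> 's \<Rightarrow> real" where
  "trans_prob t x y = \<P>(\<omega> in P x. Z t \<omega> = y)"

lemma trans_prob_nonneg: "0 \<le> trans_prob t x y"
  by (simp add: trans_prob_def)

lemma prob_split_state:
  assumes "0 \<le> t" and [measurable]: "Measurable.pred (P S) Q"
  shows "\<P>(\<omega> in P S. Q \<omega>) = (\<Sum>y\<in>UNIV. \<P>(\<omega> in P S. Q \<omega> \<and> Z t \<omega> = y))"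
proof -
  note [measurable] = Z_measurable[OF \<open>0 \<le> t\<close>]
  have "{\<omega> \<in> space (P S). Q \<omega>} = (\<Union>y\<in>UNIV. {\<omega> \<in> space (P S). Q \<omega> \<and> Z t \<omega> = y})"
    by auto
  moreover have "measure (P S) (\<Union>y\<in>UNIV. {\<omega> \<in> space (P S). Q \<omega> \<and> Z t \<omega> = y}) =
      (\<Sum>y\<in>UNIV. \<P>(\<omega> in P S. Q \<omega> \<and> Z t \<omega> = y))"
    by (rule law.finite_measure_finite_Union) (auto simp: disjoint_family_on_def)
  ultimately show ?thesis by simp
qed

lemma sum_trans_prob: "0 \<le> t \<Longrightarrow> (\<Sum>y\<in>UNIV. trans_prob t x y) = 1"
  using prob_split_state[where t = t and S = x and Q = "\<lambda>_. True"] by (simp add: trans_prob_def law.prob_space)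

text \<open>Multiplying out the conditional probability gives a product form that also covers null
  conditioning events, where both sides vanish.\<close>

lemma markov_paths:
  assumes "finite J" "J \<subseteq> {0..s}" "0 \<le> s" "0 \<le> t"
  shows "\<P>(\<omega> in P S. Z (s + t) \<omega> = y \<and> Z s \<omega> = x \<and> (\<forall>u\<in>J. Z u \<omega> = f u)) =
    \<P>(\<omega> in P S. Z s \<omega> = x \<and> (\<forall>u\<in>J. Z u \<omega> = f u)) * trans_prob t x y"
proof (cases "\<P>(\<omega> in P S. Z s \<omega> = x \<and> (\<forall>u\<in>J. Z u \<omega> = f u)) > 0")
  case True
  from markov[OF assms True, of y] True show ?thesis
    by (simp add: cond_prob_def trans_prob_def field_simps)
next
  case False
  then have 0: "\<P>(\<omega> in P S. Z s \<omega> = x \<and> (\<forall>u\<in>J. Z u \<omega> = f u)) = 0"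
    using measure_nonneg[of "P S"] by (meson not_less order_antisym)
  have [measurable]: "Measurable.pred (P S) (\<lambda>\<omega>. \<forall>u\<in>J. Z u \<omega> = f u)" 
    using assms by (intro pred_intros_finite) auto
  have "\<P>(\<omega> in P S. Z (s + t) \<omega> = y \<and> Z s \<omega> = x \<and> (\<forall>u\<in>J. Z u \<omega> = f u)) \<le>
     \<P>(\<omega> in P S. Z s \<omega> = x \<and> (\<forall>u\<in>J. Z u \<omega> = f u))"
    using assms by (intro law.finite_measure_mono) auto
  with 0 show ?thesis by (simp add: measure_le_0_iff)
qed

text \<open>The past event is a finite disjoint union of exact pasts, one for each
  \<open>f \<in> PiE J F\<close>, so \<open>markov_paths\<close> can be summed. Having avoided the
  target at finitely many grid times is an event of this form.\<close>

lemma markov_sets: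
  assumes J: "finite J" "J \<subseteq> {0..s}" and st: "0 \<le> s" "0 \<le> t"
  shows "\<P>(\<omega> in P S. Z (s + t) \<omega> = y \<and> Z s \<omega> = x \<and> (\<forall>u\<in>J. Z u \<omega> \<in> F u)) =
    \<P>(\<omega> in P S. Z s \<omega> = x \<and> (\<forall>u\<in>J. Z u \<omega> \<in> F u)) * trans_prob t x y"
proof -
  have meas [measurable]: "Measurable.pred (P S) (\<lambda>\<omega>. \<forall>u\<in>J. Z u \<omega> = f u)" for f
    using J by (intro pred_intros_finite) auto
  have split: "\<P>(\<omega> in P S. Q \<omega> \<and> (\<forall>u\<in>J. Z u \<omega> \<in> F u)) =
      (\<Sum>f\<in>PiE J F. \<P>(\<omega> in P S. Q \<omega> \<and> (\<forall>u\<in>J. Z u \<omega> = f u)))"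
    if [measurable]: "Measurable.pred (P S) Q" for Q
  proof -
    have "{\<omega> \<in> space (P S). Q \<omega> \<and> (\<forall>u\<in>J. Z u \<omega> \<in> F u)} =
        (\<Union>f\<in>PiE J F. {\<omega> \<in> space (P S). Q \<omega> \<and> (\<forall>u\<in>J. Z u \<omega> = f u)})"
    proof (intro equalityI subsetI)
      fix \<omega> assume "\<omega> \<in> {\<omega> \<in> space (P S). Q \<omega> \<and> (\<forall>u\<in>J. Z u \<omega> \<in> F u)}"
      \<comment> \<open>The path's own values, restricted to \<open>J\<close> so as to be
        extensional, select the cylinder that contains it.\<close>
      then show "\<omega> \<in> (\<Union>f\<in>PiE J F. {\<omega> \<in> space (P S). Q \<omega> \<and> (\<forall>u\<in>J. Z u \<omega> = f u)})"
        by (intro UN_I[of "restrict (\<lambda>u. Z u \<omega>) J"]) auto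
    qed (auto simp: PiE_iff)
    moreover have "measure (P S) (\<Union>f\<in>PiE J F. {\<omega> \<in> space (P S). Q \<omega> \<and> (\<forall>u\<in>J. Z u \<omega> = f u)}) =
        (\<Sum>f\<in>PiE J F. \<P>(\<omega> in P S. Q \<omega> \<and> (\<forall>u\<in>J. Z u \<omega> = f u)))"
    proof (rule law.finite_measure_finite_Union)
      show "disjoint_family_on (\<lambda>f. {\<omega> \<in> space (P S). Q \<omega> \<and> (\<forall>u\<in>J. Z u \<omega> = f u)}) (PiE J F)"
        unfolding disjoint_family_on_def
      proof (intro ballI impI equals0I)
        fix f g \<omega> assume fg: "f \<in> PiE J F" "g \<in> PiE J F" "f \<noteq> g"
          and "\<omega> \<in> {\<omega> \<in> space (P S). Q \<omega> \<and> (\<forall>u\<in>J. Z u \<omega> = f u)} \<inter>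
            {\<omega> \<in> space (P S). Q \<omega> \<and> (\<forall>u\<in>J. Z u \<omega> = g u)}"
        then have "f u = g u" if "u \<in> J" for u using that by auto
        with fg show False using PiE_ext by blast
      qed
    qed (use J in \<open>auto intro!: finite_PiE\<close>)
    ultimately show ?thesis by simp
  qed
  have "\<P>(\<omega> in P S. (Z (s + t) \<omega> = y \<and> Z s \<omega> = x) \<and> (\<forall>u\<in>J. Z u \<omega> \<in> F u)) =
      \<P>(\<omega> in P S. Z s \<omega> = x \<and> (\<forall>u\<in>J. Z u \<omega> \<in> F u)) * trans_prob t x y"
    using st markov_paths[OF J st, of S y x] by (subst (1 2) split) (auto simp: sum_distrib_right)
  then show ?thesis by (simp add: conj_assoc)
qed

lemma trans_prob_0: "trans_prob 0 x y = (if x = y then 1 else 0)"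
proof (cases "x = y")
  case False
  have "(\<Sum>z\<in>{x, y}. trans_prob 0 x z) \<le> (\<Sum>z\<in>UNIV. trans_prob 0 x z)"
    by (intro sum_mono2) (auto simp: trans_prob_nonneg)
  with False initial_state[of x] sum_trans_prob[of 0 x] trans_prob_nonneg[of 0 x y] show ?thesis
    by (simp add: trans_prob_def order_antisym)
qed (use initial_state[of x] in \<open>simp add: trans_prob_def\<close>)

lemma AE_initial: "AE \<omega> in P S. Z 0 \<omega> = S"
  using initial_state[of S] law.prob_Collect_eq_1[of S "\<lambda>\<omega>. Z 0 \<omega> = S"] by simp

section \<open>Jump rates and the generator as a small-time limit\<close>

lemma rate_nonneg: "x \<noteq> y \<Longrightarrow> 0 \<le> q x y"
  by (rule tendsto_lowerbound[OF transition_rate])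
    (auto simp: eventually_at_right_less intro!: eventually_at_rightI[of 0 1])

text \<open>Each quotient \<open>trans_prob t x y / t\<close> has a finite limit at 0, and finitely
  many pairs share one constant and one \<epsilon>. This later bounds the probability of leaving the
  target again within a short time.\<close>

lemma trans_prob_le_linear:
  "\<exists>C \<epsilon>. 0 \<le> C \<and> 0 < \<epsilon> \<and> (\<forall>t x y. 0 \<le> t \<longrightarrow> t < \<epsilon> \<longrightarrow> x \<noteq> y \<longrightarrow> trans_prob t x y \<le> C * t)"
proof -
  \<comment> \<open>Absolute values make every entry at most the full sum, whatever the diagonal
    holds; \<open>+ 1\<close> makes the bound strict, so that it persists near the limit.\<close>
  define C where "C = (\<Sum>x\<in>UNIV. \<Sum>y\<in>UNIV. \<bar>q x y\<bar>) + 1"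
  have qC: "q x y < C" for x y
  proof -
    have "\<bar>q x y\<bar> \<le> (\<Sum>y\<in>UNIV. \<bar>q x y\<bar>)" by (rule member_le_sum) auto
    also have "\<dots> \<le> (\<Sum>x\<in>UNIV. \<Sum>y\<in>UNIV. \<bar>q x y\<bar>)"
      by (rule member_le_sum[of x UNIV "\<lambda>x. \<Sum>y\<in>UNIV. \<bar>q x y\<bar>"]) (auto intro: sum_nonneg)
    finally show ?thesis by (simp add: C_def)
  qed
  have "eventually (\<lambda>t. x \<noteq> y \<longrightarrow> trans_prob t x y / t < C) (at_right 0)" for x y
    using order_tendstoD(2)[OF transition_rate qC, of x y]
    by (cases "x = y") (auto simp: trans_prob_def)
  then have "eventually (\<lambda>t. \<forall>x y. x \<noteq> y \<longrightarrow> trans_prob t x y / t < C) (at_right 0)"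
    by (intro eventually_all_finite) 
  then obtain \<epsilon> where "\<epsilon> > 0" and e: "\<And>t x y. 0 < t \<Longrightarrow> t < \<epsilon> \<Longrightarrow> x \<noteq> y \<Longrightarrow> trans_prob t x y / t < C"
    unfolding eventually_at_right_field by auto
  have "trans_prob t x y \<le> C * t" if "0 \<le> t" "t < \<epsilon>" "x \<noteq> y" for t x y
    using e[of t x y] that by (cases "t = 0") (auto simp: trans_prob_0 field_simps)
  moreover have "0 \<le> C" by (auto simp: C_def intro!: sum_nonneg add_nonneg_nonneg)
  ultimately show ?thesis using \<open>\<epsilon> > 0\<close> by blast
qed

text \<open>Rows of \<open>trans_prob t\<close> sum to 1, so \<open>f x\<close> can be moved inside
  the sum; this cancels the diagonal term, and the other quotients converge to the rates.\<close>

lemma generator_limit: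
  fixes f :: "'s \<Rightarrow> real"
  shows "((\<lambda>t. ((\<Sum>y\<in>UNIV. trans_prob t x y * f y) - f x) / t) \<longlongrightarrow>
    (\<Sum>y\<in>-{x}. q x y * (f y - f x))) (at_right 0)"
proof -
  have "((\<lambda>t. \<Sum>y\<in>-{x}. trans_prob t x y / t * (f y - f x)) \<longlongrightarrow>
      (\<Sum>y\<in>-{x}. q x y * (f y - f x))) (at_right 0)"
    by (intro tendsto_intros) (auto simp: trans_prob_def intro!: transition_rate)
  moreover have "eventually (\<lambda>t. (\<Sum>y\<in>-{x}. trans_prob t x y / t * (f y - f x)) =
      ((\<Sum>y\<in>UNIV. trans_prob t x y * f y) - f x) / t) (at_right 0)"
  proof (rule eventually_at_rightI[of 0 1])
    fix t :: real assume "t \<in> {0<..<1}"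
    then have "f x = (\<Sum>y\<in>UNIV. trans_prob t x y * f x)"
      by (simp add: sum_distrib_right[symmetric] sum_trans_prob)
    then have "(\<Sum>y\<in>UNIV. trans_prob t x y * f y) - f x = (\<Sum>y\<in>UNIV. trans_prob t x y * (f y - f x))"
      by (simp add: right_diff_distrib sum_subtractf)
    also have "\<dots> = (\<Sum>y\<in>-{x}. trans_prob t x y * (f y - f x))"
      by (rule sum.mono_neutral_right) auto
    finally show "(\<Sum>y\<in>-{x}. trans_prob t x y / t * (f y - f x)) =
      ((\<Sum>y\<in>UNIV. trans_prob t x y * f y) - f x) / t"
      by (simp add: sum_divide_distrib)
  qed simp
  ultimately show ?thesis by (rule Lim_transform_eventually)
qed

end

section \<open>The continuous hitting time: measurability, mean, positivity\<close>

locale finite_ctmc_hitting = finite_ctmc P Z q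
  for P :: "'s::finite \<Rightarrow> 'w measure" and Z :: "real \<Rightarrow> 'w \<Rightarrow> 's" and q :: "'s \<Rightarrow> 's \<Rightarrow> real" +
  fixes A :: "'s set"
  assumes finite_mean: "mean_hitting_time P Z A S < \<infinity>"
begin

abbreviation T :: "'w \<Rightarrow> real" where
  "T \<equiv> real_hitting_time Z A"

definition h :: "'s \<Rightarrow> real" where
  "h S = enn2real (mean_hitting_time P Z A S)"

lemma h_nonneg: "0 \<le> h S"
  by (simp add: h_def)

text \<open>By right-continuity a visit lasts for a positive while, so rational visits occur
  arbitrarily soon after it. The countable infimum makes the hitting time measurable.\<close>

lemma hitting_time_rational:
  assumes "\<omega> \<in> space (P S)"
  shows "hitting_time Z A \<omega> = (INF r\<in>\<rat> \<inter> {0..}. if Z r \<omega> \<in> A then ennreal r else \<infinity>)" (is "_ = ?R")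
proof (rule antisym)
  have "hitting_time Z A \<omega> \<le> ennreal r" if "0 \<le> r" "Z r \<omega> \<in> A" for r
    unfolding hitting_time_def using that by (intro INF_lower) simp
  then show "hitting_time Z A \<omega> \<le> ?R"
    by (intro INF_greatest) simp
  show "?R \<le> hitting_time Z A \<omega>"
    unfolding hitting_time_def
  proof (rule INF_greatest, rule ennreal_le_epsilon)
    fix t and e :: real assume t: "t \<in> {t. 0 \<le> t \<and> Z t \<omega> \<in> A}" and e: "0 < e"
    then obtain b where b: "t < b" "\<And>u. t < u \<Longrightarrow> u < b \<Longrightarrow> Z u \<omega> = Z t \<omega>"
      using right_continuous_paths[OF assms, of t] unfolding eventually_at_right_field by auto
    from b(1) e have "t < min b (t + e)" by simp
    then obtain r where r: "r \<in> \<rat>" "t < r" "r < min b (t + e)"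
      using Rats_dense_in_real by blast
    then have "?R \<le> (if Z r \<omega> \<in> A then ennreal r else \<infinity>)"
      using t by (intro INF_lower) auto
    also have "\<dots> \<le> ennreal (t + e)"
      using b(2)[of r] r t by (auto simp del: ennreal_plus intro!: ennreal_leI)
    finally show "?R \<le> ennreal t + ennreal e" using t e by simp
  qed
qed

lemma hitting_time_measurable [measurable]: "hitting_time Z A \<in> borel_measurable (P S)"
proof (subst measurable_cong[OF hitting_time_rational])
  have "countable (\<rat> \<inter> {0::real..})" by (simp add: countable_rat)
  moreover have "(\<lambda>\<omega>. if Z r \<omega> \<in> A then ennreal r else \<infinity>) \<in> borel_measurable (P S)"
    if "r \<in> \<rat> \<inter> {0..}" for r
  proof -
    have [measurable]: "Z r \<in> P S \<rightarrow>\<^sub>M count_space UNIV" using that by (intro measurable_state) auto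
    show ?thesis by measurable
  qed
  ultimately show "(\<lambda>\<omega>. INF r\<in>\<rat> \<inter> {0..}. if Z r \<omega> \<in> A then ennreal r else \<infinity>) \<in> borel_measurable (P S)"
    by (rule borel_measurable_INF)
qed

lemma T_measurable [measurable]: "T \<in> borel_measurable (P S)"
  unfolding real_hitting_time_def[abs_def] by measurable

lemma T_nonneg: "0 \<le> T \<omega>"
  by (simp add: real_hitting_time_def)

lemma AE_ennreal_T: "AE \<omega> in P S. ennreal (T \<omega>) = hitting_time Z A \<omega>"
proof -
  have "AE \<omega> in P S. hitting_time Z A \<omega> \<noteq> \<infinity>"
    using finite_mean[of S] by (intro nn_integral_noteq_infinite) (auto simp: mean_hitting_time_def)
  then show ?thesis by eventually_elim (simp add: real_hitting_time_def less_top)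
qed

lemma T_integrable: "integrable (P S) T"
  and expectation_T: "law.expectation S T = h S"
proof -
  have eq: "(\<integral>\<^sup>+\<omega>. ennreal (T \<omega>) \<partial>P S) = mean_hitting_time P Z A S"
    unfolding mean_hitting_time_def by (rule nn_integral_cong_AE[OF AE_ennreal_T])
  then show "integrable (P S) T"
    using finite_mean[of S] by (intro integrableI_nonneg) (auto simp: T_nonneg)
  show "law.expectation S T = h S"
    by (subst integral_eq_nn_integral) (auto simp: T_nonneg eq h_def)
qed

lemma T_le: "0 \<le> t \<Longrightarrow> Z t \<omega> \<in> A \<Longrightarrow> T \<omega> \<le> t"
  unfolding real_hitting_time_def hitting_time_def
  by (rule enn2real_leI) (auto intro: INF_lower)

lemma AE_T_eq_0: "S \<in> A \<Longrightarrow> AE \<omega> in P S. T \<omega> = 0"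
  using AE_initial[of S]
proof eventually_elim
  case (elim \<omega>)
  then have "T \<omega> \<le> 0" by (intro T_le) auto
  with T_nonneg[of \<omega>] show ?case by simp
qed

text \<open>Right-continuity at time 0: the path stays in \<open>S\<close> up to a positive,
  path-dependent time.\<close>

lemma AE_T_pos:
  assumes "S \<notin> A"
  shows "AE \<omega> in P S. 0 < T \<omega>"
  using AE_initial[of S] AE_ennreal_T[of S] AE_space
proof eventually_elim
  case (elim \<omega>)
  obtain b where b: "0 < b" "\<And>u. 0 < u \<Longrightarrow> u < b \<Longrightarrow> Z u \<omega> = S"
    using right_continuous_paths[OF elim(3), of 0] elim(1) unfolding eventually_at_right_field by auto
  have "ennreal b \<le> hitting_time Z A \<omega>"
    unfolding hitting_time_def
  proof (intro INF_greatest ennreal_leI)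
    fix t assume "t \<in> {t. 0 \<le> t \<and> Z t \<omega> \<in> A}"
    with b(2)[of t] elim(1) assms show "b \<le> t" by (cases "t = 0") force+
  qed
  with elim(2) have "ennreal b \<le> ennreal (T \<omega>)" by simp
  then have "b \<le> T \<omega>" using T_nonneg[of \<omega>] by (simp add: ennreal_le_iff)
  with b(1) show ?case by simp
qed

text \<open>Continuity from above: the events decrease to \<open>T \<omega> \<le> 0\<close>, which
  is null by \<open>AE_T_pos\<close>. This makes the error factor \<kappa> of
  \<open>mean_step\<close> vanish in the limit.\<close>

lemma prob_T_small:
  assumes "S \<notin> A"
  shows "(\<lambda>n. \<P>(\<omega> in P S. T \<omega> \<le> inverse (real (Suc n)))) \<longlonglongrightarrow> 0"
proof -
  define B where "B n = {\<omega> \<in> space (P S). T \<omega> \<le> inverse (real (Suc n))}" for n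
  have "(\<lambda>n. measure (P S) (B n)) \<longlonglongrightarrow> measure (P S) (\<Inter>n. B n)"
  proof (rule law.finite_Lim_measure_decseq)
    show "decseq B"
      by (rule decseq_SucI) (auto simp: B_def intro: order_trans le_imp_inverse_le)
  qed (auto simp: B_def)
  also have "measure (P S) (\<Inter>n. B n) = measure (P S) {}"
  proof (rule measure_eq_AE)
    show "AE \<omega> in P S. (\<omega> \<in> (\<Inter>n. B n)) = (\<omega> \<in> {})"
      using AE_T_pos[OF assms]
    proof eventually_elim
      case (elim \<omega>)
      then obtain n where "inverse (real (Suc n)) < T \<omega>" using reals_Archimedean by blast
      then show ?case by (auto simp: B_def not_le)
    qed
  qed (auto simp: B_def)
  finally show ?thesis by (simp add: B_def)
qed

section \<open>The grid chain killed on the target\<close>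

text \<open>Index \<open>j\<close> is included, so the first grid visit to \<open>A\<close> comes
  after step \<open>j\<close>; the predicate is antitone in \<open>j\<close>.\<close>

definition avoids :: "real \<Rightarrow> nat \<Rightarrow> 'w \<Rightarrow> bool" where
  "avoids s j \<omega> \<longleftrightarrow> (\<forall>i\<le>j. Z (real i * s) \<omega> \<notin> A)"

lemma avoids_measurable:
  assumes "0 \<le> s"
  shows "Measurable.pred (P S) (avoids s j)"
proof -
  have "Measurable.pred (P S) (\<lambda>\<omega>. Z (real i * s) \<omega> \<notin> A)" for i
  proof -
    have [measurable]: "Z (real i * s) \<in> P S \<rightarrow>\<^sub>M count_space UNIV"
      using assms by (intro measurable_state) simp
    show ?thesis by measurable
  qed
  then have "Measurable.pred (P S) (\<lambda>\<omega>. \<forall>i\<in>{..j}. Z (real i * s) \<omega> \<notin> A)"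
    by (intro pred_intros_finite) simp_all
  also have "(\<lambda>\<omega>. \<forall>i\<in>{..j}. Z (real i * s) \<omega> \<notin> A) = avoids s j"
    by (auto simp: avoids_def)
  finally show ?thesis .
qed

text \<open>The \<open>j\<close>-step matrix of the grid chain killed in \<open>A\<close>; it is
  substochastic.\<close>

definition killed_prob :: "real \<Rightarrow> nat \<Rightarrow> 's \<Rightarrow> 's \<Rightarrow> real" where
  "killed_prob s j x y = \<P>(\<omega> in P x. avoids s j \<omega> \<and> Z (real j * s) \<omega> = y)"

lemma killed_prob_nonneg: "0 \<le> killed_prob s j x y"
  by (simp add: killed_prob_def)

lemma prob_avoids: "0 \<le> s \<Longrightarrow> \<P>(\<omega> in P x. avoids s j \<omega>) = (\<Sum>y\<in>UNIV. killed_prob s j x y)"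
  unfolding killed_prob_def by (intro prob_split_state) (auto intro: avoids_measurable)

lemma killed_prob_target: "y \<in> A \<Longrightarrow> killed_prob s j x y = 0"
proof -
  assume "y \<in> A"
  then have "{\<omega> \<in> space (P x). avoids s j \<omega> \<and> Z (real j * s) \<omega> = y} = {}"
    by (auto simp: avoids_def)
  then show ?thesis unfolding killed_prob_def by (metis measure_empty)
qed

lemma killed_prob_0: "killed_prob s 0 x y = of_bool (x = y \<and> y \<notin> A)"
proof (cases "y \<in> A")
  case False
  then have "killed_prob s 0 x y = trans_prob 0 x y"
    unfolding killed_prob_def trans_prob_def by (auto simp: avoids_def intro!: arg_cong[where f = "measure (P x)"])
  with False show ?thesis by (simp add: trans_prob_0)
qed (simp add: killed_prob_target)

text \<open>Markov property at time \<open>real j * s\<close>, with avoidance at the earlier grid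
  points as the past; a step landing in \<open>A\<close> is killed.\<close>

lemma killed_prob_Suc:
  assumes s: "0 \<le> s"
  shows "killed_prob s (Suc j) x y = (if y \<in> A then 0 else \<Sum>z\<in>UNIV. killed_prob s j x z * trans_prob s z y)"
proof (cases "y \<in> A")
  case False
  note [measurable] = avoids_measurable[OF s]
  let ?t = "real j * s"
  have avoids: "avoids s j = (\<lambda>\<omega>. \<forall>u\<in>(\<lambda>i. real i * s) ` {..j}. Z u \<omega> \<in> -A)"
    by (auto simp: avoids_def)
  have "killed_prob s (Suc j) x y = \<P>(\<omega> in P x. avoids s j \<omega> \<and> Z (?t + s) \<omega> = y)"
    unfolding killed_prob_def using False
    by (intro arg_cong[where f = "measure (P x)"])
      (auto simp: avoids_def le_Suc_eq algebra_simps)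
  also have "\<dots> = (\<Sum>z\<in>UNIV. \<P>(\<omega> in P x. (avoids s j \<omega> \<and> Z (?t + s) \<omega> = y) \<and> Z ?t \<omega> = z))"
    using s by (intro prob_split_state) auto
  also have "\<dots> = (\<Sum>z\<in>UNIV. killed_prob s j x z * trans_prob s z y)"
  proof (rule sum.cong[OF refl])
    fix z
    have "\<P>(\<omega> in P x. Z (?t + s) \<omega> = y \<and> Z ?t \<omega> = z \<and> avoids s j \<omega>) =
        \<P>(\<omega> in P x. Z ?t \<omega> = z \<and> avoids s j \<omega>) * trans_prob s z y"
      unfolding avoids using s by (intro markov_sets) (auto simp: mult_right_mono)
    then show "\<P>(\<omega> in P x. (avoids s j \<omega> \<and> Z (?t + s) \<omega> = y) \<and> Z ?t \<omega> = z) =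
        killed_prob s j x z * trans_prob s z y"
      by (simp add: killed_prob_def conj_ac)
  qed
  finally show ?thesis using False by simp
qed (simp add: killed_prob_target)

text \<open>Chapman-Kolmogorov for the killed chain, derived from the one-step recursion by
  induction.\<close>

lemma killed_prob_add:
  assumes "0 \<le> s"
  shows "killed_prob s (n + i) x z = (\<Sum>y\<in>UNIV. killed_prob s n x y * killed_prob s i y z)"
proof (induction i arbitrary: z)
  case 0
  have "(\<Sum>y\<in>UNIV. killed_prob s n x y * killed_prob s 0 y z) =
      (\<Sum>y\<in>UNIV. if y = z then killed_prob s n x y else 0)"
    by (intro sum.cong) (auto simp: killed_prob_0 killed_prob_target)
  then show ?case by simp
next
  case (Suc i)
  show ?case
  proof (cases "z \<in> A")
    case False
    then have "killed_prob s (n + Suc i) x z =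
        (\<Sum>u\<in>UNIV. \<Sum>y\<in>UNIV. killed_prob s n x y * killed_prob s i y u * trans_prob s u z)"
      by (simp add: killed_prob_Suc assms Suc.IH sum_distrib_right)
    also have "\<dots> = (\<Sum>y\<in>UNIV. killed_prob s n x y * killed_prob s (Suc i) y z)"
      using False by (subst sum.swap) (simp add: killed_prob_Suc assms sum_distrib_left mult.assoc)
    finally show ?thesis .
  qed (simp add: killed_prob_target)
qed

section \<open>The grid hitting time and its comparison with \<open>T\<close>\<close>

text \<open>As \<open>avoids s j \<omega>\<close> is antitone in \<open>j\<close>, the sum counts
  the steps before the first grid visit to \<open>A\<close>: this is the grid hitting time capped at
  \<open>real k * s\<close>.\<close>

definition grid_time :: "real \<Rightarrow> nat \<Rightarrow> 'w \<Rightarrow> real" where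
  "grid_time s k \<omega> = s * (\<Sum>j<k. of_bool (avoids s j \<omega>))"

lemma grid_time_measurable: "0 \<le> s \<Longrightarrow> grid_time s k \<in> borel_measurable (P S)"
proof -
  assume "0 \<le> s"
  note [measurable] = avoids_measurable[OF this]
  show ?thesis unfolding grid_time_def[abs_def] of_bool_def by measurable
qed

lemma grid_time_bounds:
  assumes "0 \<le> s"
  shows "0 \<le> grid_time s k \<omega>" "grid_time s k \<omega> \<le> real k * s"
proof -
  have "(\<Sum>j<k. of_bool (avoids s j \<omega>)) \<le> (\<Sum>j<k. 1::real)" by (intro sum_mono) auto
  from mult_left_mono[OF this assms] show "grid_time s k \<omega> \<le> real k * s"
    by (simp add: grid_time_def mult.commute)
  show "0 \<le> grid_time s k \<omega>" using assms by (auto simp: grid_time_def intro!: mult_nonneg_nonneg sum_nonneg)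
qed

lemma grid_time_integrable: "0 \<le> s \<Longrightarrow> integrable (P S) (grid_time s k)"
  using grid_time_bounds[of s k]
  by (intro law.integrable_const_bound[where B = "real k * s"]) (auto intro: grid_time_measurable)

lemma expectation_avoids:
  assumes "0 \<le> s"
  shows "law.expectation x (\<lambda>\<omega>. of_bool (avoids s j \<omega>)) = (\<Sum>y\<in>UNIV. killed_prob s j x y)"
    and "integrable (P x) (\<lambda>\<omega>. of_bool (avoids s j \<omega>) :: real)"
proof -
  note [measurable] = avoids_measurable[OF assms]
  have "law.expectation x (\<lambda>\<omega>. of_bool (avoids s j \<omega>)) =
      law.expectation x (indicator {\<omega> \<in> space (P x). avoids s j \<omega>})"
    by (intro Bochner_Integration.integral_cong) (auto simp: indicator_def)
  also have "\<dots> = \<P>(\<omega> in P x. avoids s j \<omega>)"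
    by (subst Bochner_Integration.integral_indicator) (auto intro: arg_cong[where f = "measure (P x)"])
  finally show "law.expectation x (\<lambda>\<omega>. of_bool (avoids s j \<omega>)) = (\<Sum>y\<in>UNIV. killed_prob s j x y)"
    by (simp add: prob_avoids[OF assms])
  show "integrable (P x) (\<lambda>\<omega>. of_bool (avoids s j \<omega>) :: real)"
    by (intro law.integrable_const_bound[where B = 1]) (auto simp: of_bool_def)
qed

lemma expectation_grid_time:
  assumes "0 \<le> s"
  shows "law.expectation x (grid_time s k) = s * (\<Sum>j<k. \<Sum>y\<in>UNIV. killed_prob s j x y)"
  using expectation_avoids[OF assms] by (simp add: grid_time_def[abs_def] del: sum_of_bool_eq)

text \<open>Paths that survive \<open>n\<close> steps restart from their current state; the last
  \<open>k\<close> terms are rewritten by \<open>killed_prob_add\<close>.\<close>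

lemma expectation_grid_time_add:
  assumes "0 \<le> s"
  shows "law.expectation x (grid_time s (n + k)) = law.expectation x (grid_time s n) +
    (\<Sum>y\<in>UNIV. killed_prob s n x y * law.expectation y (grid_time s k))"
proof -
  have "(\<Sum>j<n + k. \<Sum>z\<in>UNIV. killed_prob s j x z) =
      (\<Sum>j<n. \<Sum>z\<in>UNIV. killed_prob s j x z) + (\<Sum>i<k. \<Sum>z\<in>UNIV. killed_prob s (n + i) x z)"
    by (induction k) (simp_all add: add.assoc)
  also have "(\<Sum>i<k. \<Sum>z\<in>UNIV. killed_prob s (n + i) x z) =
      (\<Sum>i<k. \<Sum>y\<in>UNIV. \<Sum>z\<in>UNIV. killed_prob s n x y * killed_prob s i y z)"
    unfolding killed_prob_add[OF assms] by (rule sum.cong[OF refl sum.swap])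
  also have "\<dots> = (\<Sum>y\<in>UNIV. killed_prob s n x y * (\<Sum>i<k. \<Sum>z\<in>UNIV. killed_prob s i y z))"
    by (subst sum.swap) (simp add: sum_distrib_left)
  finally show ?thesis
    by (simp add: expectation_grid_time assms distrib_left sum_distrib_left mult_ac)
qed

text \<open>A grid visit is a visit of the path, so watching only the grid can only delay
  detection.\<close>

lemma min_T_le_grid_time:
  assumes "0 \<le> s"
  shows "min (T \<omega>) (real k * s) \<le> grid_time s k \<omega>"
proof (cases "\<exists>i<k. Z (real i * s) \<omega> \<in> A")
  case True
  define i where "i = (LEAST i. i < k \<and> Z (real i * s) \<omega> \<in> A)"
  have i: "i < k" "Z (real i * s) \<omega> \<in> A" using LeastI_ex[OF True] by (auto simp: i_def)
  have before: "avoids s j \<omega>" if "j < i" for j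
    unfolding avoids_def
  proof (intro allI impI)
    fix l assume "l \<le> j"
    then have "l < i" "l < k" using that i by auto
    then show "Z (real l * s) \<omega> \<notin> A" using not_less_Least[of l] by (auto simp: i_def)
  qed
  have "T \<omega> \<le> real i * s" using i assms by (intro T_le) auto
  also have "\<dots> = s * (\<Sum>j<i. of_bool (avoids s j \<omega>))" using before by simp
  also have "\<dots> \<le> grid_time s k \<omega>"
    unfolding grid_time_def using i assms by (intro mult_left_mono sum_mono2) auto
  finally show ?thesis by simp
next
  case False
  then have "avoids s j \<omega>" if "j < k" for j using that by (auto simp: avoids_def)
  then show ?thesis by (simp add: grid_time_def mult.commute)
qed

text \<open>A visit at index \<open>i\<close> falsifies \<open>avoids s j\<close> for all
  \<open>j \<ge> i\<close>, leaving at most \<open>i\<close> nonzero terms.\<close>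

lemma grid_time_le:
  assumes "0 \<le> s" "Z (real i * s) \<omega> \<in> A"
  shows "grid_time s k \<omega> \<le> real i * s"
proof -
  have "(\<Sum>j<k. of_bool (avoids s j \<omega>) :: real) \<le> (\<Sum>j<k. of_bool (j < i))"
    using assms by (intro sum_mono) (force simp: avoids_def not_less of_bool_def)
  also have "\<dots> = real (card ({..<k} \<inter> {..<i}))"
    by (simp add: of_bool_def sum.If_cases lessThan_def Collect_conj_eq[symmetric])
  also have "\<dots> \<le> real i" using card_mono[of "{..<i}" "{..<k} \<inter> {..<i}"] by simp
  finally show ?thesis
    unfolding grid_time_def using assms(1) by (subst mult.commute) (rule mult_right_mono)
qed

text \<open>Dividing each period \<epsilon> into \<open>Suc m\<close> steps refines the mesh while
  the horizon stays at \<open>real K * \<epsilon>\<close>.\<close>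

lemma grid_end: "real (K * Suc m) * (\<epsilon> / real (Suc m)) = real K * \<epsilon>"
  unfolding of_nat_mult by (simp del: of_nat_Suc)

text \<open>The lower bound is \<open>min_T_le_grid_time\<close>. For the upper bound, a visit close
  to the infimum lasts for a while, and every sufficiently fine grid has a point in that
  while.\<close>

lemma AE_grid_time_tendsto:
  assumes \<epsilon>: "0 < \<epsilon>"
  shows "AE \<omega> in P S. (\<lambda>m. grid_time (\<epsilon> / real (Suc m)) (K * Suc m) \<omega>) \<longlonglongrightarrow> min (T \<omega>) (real K * \<epsilon>)"
  using AE_ennreal_T[of S] AE_space
proof eventually_elim
  case (elim \<omega>)
  let ?G = "\<lambda>m. grid_time (\<epsilon> / real (Suc m)) (K * Suc m) \<omega>"
  have lower: "min (T \<omega>) (real K * \<epsilon>) \<le> ?G m" for m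
    using min_T_le_grid_time[of "\<epsilon> / real (Suc m)" \<omega> "K * Suc m", unfolded grid_end] \<epsilon> by simp
  have upper: "?G m \<le> real K * \<epsilon>" for m
    using grid_time_bounds(2)[of "\<epsilon> / real (Suc m)" "K * Suc m" \<omega>, unfolded grid_end] \<epsilon> by simp
  show ?case
  proof (rule LIMSEQ_I)
    fix e :: real assume e: "0 < e"
    have "hitting_time Z A \<omega> < ennreal (T \<omega> + e / 2)"
      unfolding elim(1)[symmetric] using e T_nonneg[of \<omega>] by (intro ennreal_lessI) auto
    then obtain t where t: "0 \<le> t" "Z t \<omega> \<in> A" "t < T \<omega> + e / 2"
      by (auto simp: hitting_time_def INF_less_iff ennreal_less_iff)
    obtain b where b: "t < b" "\<And>u. t < u \<Longrightarrow> u < b \<Longrightarrow> Z u \<omega> = Z t \<omega>"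
      using right_continuous_paths[OF elim(2) t(1)] unfolding eventually_at_right_field by auto
    \<comment> \<open>The bound \<open>b - t\<close> keeps the grid point within the stay in
      \<open>A\<close>, and \<open>e / 2\<close> keeps it close to
      \<open>T \<omega>\<close>.\<close>
    define d where "d = min (b - t) (e / 2)"
    have "0 < d" using b(1) e by (simp add: d_def)
    moreover have "(\<lambda>m. \<epsilon> / real (Suc m)) \<longlonglongrightarrow> 0"
      by real_asymp
    ultimately have "eventually (\<lambda>m. \<epsilon> / real (Suc m) < d) sequentially"
      by (intro order_tendstoD(2))
    then obtain M where M: "\<And>m. m \<ge> M \<Longrightarrow> \<epsilon> / real (Suc m) < d"
      unfolding eventually_sequentially by blast
    show "\<exists>M. \<forall>m\<ge>M. norm (?G m - min (T \<omega>) (real K * \<epsilon>)) < e"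
    proof (intro exI allI impI)
      fix m assume "M \<le> m"
      define s where "s = \<epsilon> / real (Suc m)"
      have s: "0 < s" "s < d" using \<epsilon> M[OF \<open>M \<le> m\<close>] by (simp_all add: s_def del: of_nat_Suc)
      \<comment> \<open>The first grid index at or after \<open>t\<close>; its time overshoots
        \<open>t\<close> by less than \<open>s\<close>.\<close>
      define i where "i = nat \<lceil>t / s\<rceil>"
      have "0 \<le> t / s" using t s by simp
      then have "t / s \<le> real i" "real i < t / s + 1"
        unfolding i_def by linarith+
      then have i: "t \<le> real i * s" "real i * s < t + s"
        using s by (simp_all add: field_simps)
      have "Z (real i * s) \<omega> \<in> A"
        using b(2)[of "real i * s"] t i s by (cases "real i * s = t") (auto simp: d_def)
      then have "?G m \<le> real i * s"
        unfolding s_def[symmetric] using s by (intro grid_time_le) auto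
      also have "\<dots> < T \<omega> + e" using i s t by (simp add: d_def)
      finally show "norm (?G m - min (T \<omega>) (real K * \<epsilon>)) < e"
        using lower[of m] upper[of m] e by (auto simp: min_def split: if_splits)
    qed
  qed
qed

lemma expectation_grid_time_tendsto:
  assumes \<epsilon>: "0 < \<epsilon>"
  shows "(\<lambda>m. law.expectation S (grid_time (\<epsilon> / real (Suc m)) (K * Suc m))) \<longlonglongrightarrow>
    law.expectation S (\<lambda>\<omega>. min (T \<omega>) (real K * \<epsilon>))"
proof (rule integral_dominated_convergence[where w = "\<lambda>_. real K * \<epsilon>"])
  show "AE \<omega> in P S. norm (grid_time (\<epsilon> / real (Suc m)) (K * Suc m) \<omega>) \<le> real K * \<epsilon>" for m
    using grid_time_bounds[of "\<epsilon> / real (Suc m)" "K * Suc m", unfolded grid_end] \<epsilon> by simp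
qed (use \<epsilon> in \<open>auto simp del: of_nat_Suc mult_Suc_right intro!: AE_grid_time_tendsto grid_time_measurable\<close>)

lemma expectation_min_T_tendsto:
  assumes \<epsilon>: "0 < \<epsilon>"
  shows "(\<lambda>K. law.expectation S (\<lambda>\<omega>. min (T \<omega>) (real K * \<epsilon>))) \<longlonglongrightarrow> h S"
proof -
  have "(\<lambda>K. law.expectation S (\<lambda>\<omega>. min (T \<omega>) (real K * \<epsilon>))) \<longlonglongrightarrow> law.expectation S T"
  proof (rule integral_dominated_convergence[where w = T])
    show "AE \<omega> in P S. (\<lambda>K. min (T \<omega>) (real K * \<epsilon>)) \<longlonglongrightarrow> T \<omega>"
    proof (rule AE_I2, rule tendsto_eventually)
      fix \<omega>
      have "filterlim (\<lambda>K. real K * \<epsilon>) at_top sequentially" using \<epsilon> by real_asymp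
      then have "eventually (\<lambda>K. T \<omega> \<le> real K * \<epsilon>) sequentially"
        by (simp add: filterlim_at_top)
      then show "eventually (\<lambda>K. min (T \<omega>) (real K * \<epsilon>) = T \<omega>) sequentially"
        by eventually_elim simp
    qed
    show "AE \<omega> in P S. norm (min (T \<omega>) (real K * \<epsilon>)) \<le> T \<omega>" for K
      using \<epsilon> T_nonneg by (intro AE_I2) (simp add: min_def)
  qed (auto simp: T_integrable)
  then show ?thesis by (simp add: expectation_T)
qed

section \<open>The generator inequality for \<open>h\<close>\<close>

text \<open>
  Entering \<open>A\<close> and leaving it again within time \<open>\<epsilon>\<close> has probability \<open>o(\<epsilon>)\<close>: decomposing at the
  first grid visit to \<open>A\<close>, the exit afterwards costs a factor \<open>C \<epsilon>\<close>.
\<close>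

lemma killed_prob_lower:
  assumes C: "\<And>t x y. 0 \<le> t \<Longrightarrow> t \<le> \<epsilon> \<Longrightarrow> x \<noteq> y \<Longrightarrow> trans_prob t x y \<le> C * \<epsilon>" "0 \<le> C"
    and s: "0 \<le> s" "real n * s = \<epsilon>" and y: "y \<notin> A"
  shows "trans_prob \<epsilon> x y - C * \<epsilon> * \<P>(\<omega> in P x. T \<omega> \<le> \<epsilon>) \<le> killed_prob s n x y"
proof -
  note [measurable] = avoids_measurable[OF s(1)]
  have "0 \<le> \<epsilon>" using s by auto
  note [measurable] = Z_measurable[OF this]
  have Zs [measurable]: "Z (real i * s) \<in> P x \<rightarrow>\<^sub>M count_space UNIV" for i
    using s by (intro measurable_state) simp
  \<comment> \<open>Only strictly earlier grid points count, so the events \<open>first i\<close>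
    are disjoint and split the failure of \<open>avoids s n\<close> by the index of the first
    visit.\<close>
  define before where "before i \<omega> \<longleftrightarrow> (\<forall>u\<in>(\<lambda>l. real l * s) ` {..<i}. Z u \<omega> \<in> -A)" for i \<omega>
  have before_meas [measurable]: "Measurable.pred (P x) (before i)" for i
    unfolding before_def[abs_def] by (intro pred_intros_finite) auto
  define first where "first i \<omega> \<longleftrightarrow> Z (real i * s) \<omega> \<in> A \<and> before i \<omega>" for i \<omega>
  have first_meas [measurable]: "Measurable.pred (P x) (first i)" for i
    unfolding first_def[abs_def] by measurable
  have first_ex: "\<exists>i\<in>{..n}. first i \<omega>" if "\<not> avoids s n \<omega>" for \<omega>
  proof -
    from that obtain j where "j \<le> n \<and> Z (real j * s) \<omega> \<in> A" by (auto simp: avoids_def)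
    then have ex: "\<exists>j. j \<le> n \<and> Z (real j * s) \<omega> \<in> A" by blast
    define i where "i = (LEAST j. j \<le> n \<and> Z (real j * s) \<omega> \<in> A)"
    have i: "i \<le> n" "Z (real i * s) \<omega> \<in> A" using LeastI_ex[OF ex] by (auto simp: i_def)
    have "Z (real l * s) \<omega> \<notin> A" if "l < i" for l
    proof -
      have "\<not> (l \<le> n \<and> Z (real l * s) \<omega> \<in> A)" using that unfolding i_def by (rule not_less_Least)
      with that i show ?thesis by simp
    qed
    with i show ?thesis by (auto simp: first_def before_def)
  qed
  \<comment> \<open>Markov property at the first visit: going from \<open>A\<close> to
    \<open>y\<close> outside \<open>A\<close> in the remaining time, which is at most \<epsilon>,
    has probability at most \<open>C * \<epsilon>\<close>.\<close>
  have exit: "\<P>(\<omega> in P x. first i \<omega> \<and> Z \<epsilon> \<omega> = y) \<le> C * \<epsilon> * \<P>(\<omega> in P x. first i \<omega>)" if "i \<le> n" for i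
  proof -
    let ?u = "real i * s"
    have u: "0 \<le> ?u" "?u \<le> \<epsilon>" using s that by (auto intro!: mult_right_mono)
    have "\<P>(\<omega> in P x. (first i \<omega> \<and> Z \<epsilon> \<omega> = y) \<and> Z ?u \<omega> = z) \<le>
        C * \<epsilon> * \<P>(\<omega> in P x. first i \<omega> \<and> Z ?u \<omega> = z)" for z
    proof (cases "z \<in> A")
      case True
      have "\<P>(\<omega> in P x. (first i \<omega> \<and> Z \<epsilon> \<omega> = y) \<and> Z ?u \<omega> = z) =
          \<P>(\<omega> in P x. Z (?u + (\<epsilon> - ?u)) \<omega> = y \<and> Z ?u \<omega> = z \<and> before i \<omega>)"
        using True by (intro arg_cong[where f = "measure (P x)"]) (auto simp: first_def)
      also have "\<dots> = \<P>(\<omega> in P x. Z ?u \<omega> = z \<and> before i \<omega>) * trans_prob (\<epsilon> - ?u) z y"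
        unfolding before_def using s(1) u by (intro markov_sets) (auto simp: mult_right_mono)
      also have "\<dots> \<le> \<P>(\<omega> in P x. Z ?u \<omega> = z \<and> before i \<omega>) * (C * \<epsilon>)"
        using u True y by (intro mult_left_mono C) auto
      also have "\<P>(\<omega> in P x. Z ?u \<omega> = z \<and> before i \<omega>) = \<P>(\<omega> in P x. first i \<omega> \<and> Z ?u \<omega> = z)"
        using True by (intro arg_cong[where f = "measure (P x)"]) (auto simp: first_def)
      finally show ?thesis by (simp add: mult.commute)
    next
      case False
      then have "{\<omega> \<in> space (P x). (first i \<omega> \<and> Z \<epsilon> \<omega> = y) \<and> Z ?u \<omega> = z} = {}"
        by (auto simp: first_def)
      then have "\<P>(\<omega> in P x. (first i \<omega> \<and> Z \<epsilon> \<omega> = y) \<and> Z ?u \<omega> = z) = 0"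
        by (metis measure_empty)
      then show ?thesis using C(2) \<open>0 \<le> \<epsilon>\<close> by simp
    qed
    then have "(\<Sum>z\<in>UNIV. \<P>(\<omega> in P x. (first i \<omega> \<and> Z \<epsilon> \<omega> = y) \<and> Z ?u \<omega> = z)) \<le>
        C * \<epsilon> * (\<Sum>z\<in>UNIV. \<P>(\<omega> in P x. first i \<omega> \<and> Z ?u \<omega> = z))"
      unfolding sum_distrib_left by (intro sum_mono)
    then show ?thesis
      using u by (subst (1 2) prob_split_state[where t = ?u]) auto
  qed
  have "trans_prob \<epsilon> x y = measure (P x) ({\<omega> \<in> space (P x). avoids s n \<omega> \<and> Z \<epsilon> \<omega> = y} \<union>
      {\<omega> \<in> space (P x). \<not> avoids s n \<omega> \<and> Z \<epsilon> \<omega> = y})"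
    unfolding trans_prob_def by (intro arg_cong[where f = "measure (P x)"]) auto
  also have "\<dots> \<le> killed_prob s n x y + \<P>(\<omega> in P x. \<not> avoids s n \<omega> \<and> Z \<epsilon> \<omega> = y)"
    unfolding killed_prob_def s(2) by (intro measure_Un_le) auto
  also have "\<P>(\<omega> in P x. \<not> avoids s n \<omega> \<and> Z \<epsilon> \<omega> = y) \<le>
      measure (P x) (\<Union>i\<in>{..n}. {\<omega> \<in> space (P x). first i \<omega> \<and> Z \<epsilon> \<omega> = y})"
    using first_ex by (intro law.finite_measure_mono) auto
  also have "\<dots> \<le> (\<Sum>i\<in>{..n}. \<P>(\<omega> in P x. first i \<omega> \<and> Z \<epsilon> \<omega> = y))"
    by (intro measure_UNION_le) auto
  also have "\<dots> \<le> (\<Sum>i\<in>{..n}. C * \<epsilon> * \<P>(\<omega> in P x. first i \<omega>))"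
    by (intro sum_mono exit) auto
  \<comment> \<open>Disjointness turns the sum back into one event inside
    \<open>T \<omega> \<le> \<epsilon>\<close>, so the bound does not grow with the number of grid
    points.\<close>
  also have "\<dots> = C * \<epsilon> * measure (P x) (\<Union>i\<in>{..n}. {\<omega> \<in> space (P x). first i \<omega>})"
  proof (subst law.finite_measure_finite_Union)
    have "i = j" if "first i \<omega>" "first j \<omega>" for i j \<omega>
      using that by (cases i j rule: linorder_cases) (auto simp: first_def before_def)
    then show "disjoint_family_on (\<lambda>i. {\<omega> \<in> space (P x). first i \<omega>}) {..n}"
      unfolding disjoint_family_on_def by blast
  qed (auto simp: sum_distrib_left)
  also have "\<dots> \<le> C * \<epsilon> * \<P>(\<omega> in P x. T \<omega> \<le> \<epsilon>)"
  proof (intro mult_left_mono law.finite_measure_mono)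
    have "T \<omega> \<le> \<epsilon>" if "i \<le> n" "first i \<omega>" for i \<omega>
    proof -
      have "T \<omega> \<le> real i * s" using that s by (intro T_le) (auto simp: first_def)
      also have "\<dots> \<le> real n * s" using that s by (intro mult_right_mono) auto
      finally show ?thesis using s by simp
    qed
    then show "(\<Union>i\<in>{..n}. {\<omega> \<in> space (P x). first i \<omega>}) \<subseteq> {\<omega> \<in> space (P x). T \<omega> \<le> \<epsilon>}"
      by auto
  qed (use C \<open>0 \<le> \<epsilon>\<close> in auto)
  finally show ?thesis by simp
qed

text \<open>The mean time splits into the part up to \<epsilon> and a restart from a survivor's
  state, weighted from below by \<open>killed_prob_lower\<close>. The split is made for grid times,
  which dominate the truncated \<open>T\<close>; then the mesh tends to 0 and finally the horizon to
  infinity.\<close>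

lemma mean_step:
  assumes S: "S \<notin> A" and \<epsilon>: "0 < \<epsilon>"
    and C: "\<And>t x y. 0 \<le> t \<Longrightarrow> t \<le> \<epsilon> \<Longrightarrow> x \<noteq> y \<Longrightarrow> trans_prob t x y \<le> C * \<epsilon>" "0 \<le> C"
  defines "\<kappa> \<equiv> \<P>(\<omega> in P S. T \<omega> \<le> \<epsilon>)"
  shows "\<epsilon> * (1 - \<kappa>) + (\<Sum>y\<in>UNIV. (trans_prob \<epsilon> S y - C * \<epsilon> * \<kappa>) * h y) \<le> h S"
proof -
  define m where "m y K = law.expectation y (\<lambda>\<omega>. min (T \<omega>) (real K * \<epsilon>))" for y K
  have min_integrable: "integrable (P y) (\<lambda>\<omega>. min (T \<omega>) (real K * \<epsilon>))" for y K
    using \<epsilon> T_nonneg by (intro law.integrable_const_bound[where B = "real K * \<epsilon>"]) (auto simp: min_def)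
  have m_nonneg: "0 \<le> m y K" for y K
    unfolding m_def using \<epsilon> T_nonneg by (intro integral_nonneg_AE) auto
  have m_target: "m y K = 0" if "y \<in> A" for y K
  proof -
    have "m y K = law.expectation y (\<lambda>\<omega>. 0)"
      unfolding m_def using AE_T_eq_0[OF that] \<epsilon> by (intro integral_cong_AE) auto
    then show ?thesis by simp
  qed
  \<comment> \<open>The truncated time equals \<epsilon> where
    \<open>T \<omega> > \<epsilon>\<close> and is nonnegative elsewhere.\<close>
  have "\<epsilon> * (1 - \<kappa>) = law.expectation S (\<lambda>\<omega>. \<epsilon> * indicator {\<omega> \<in> space (P S). \<not> T \<omega> \<le> \<epsilon>} \<omega>)"
    by (simp add: \<kappa>_def law.prob_neg Int_absorb2 Collect_mono)
  also have "\<dots> \<le> m S 1"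
    unfolding m_def
  proof (rule integral_mono[OF _ min_integrable])
    show "integrable (P S) (\<lambda>\<omega>. \<epsilon> * indicator {\<omega> \<in> space (P S). \<not> T \<omega> \<le> \<epsilon>} \<omega>)"
      using \<epsilon> by (intro law.integrable_const_bound[where B = \<epsilon>]) (auto simp: indicator_def)
  qed (use \<epsilon> T_nonneg in \<open>auto simp: indicator_def\<close>)
  finally have first: "\<epsilon> * (1 - \<kappa>) \<le> m S 1" .
  have "\<epsilon> * (1 - \<kappa>) + (\<Sum>y\<in>UNIV. (trans_prob \<epsilon> S y - C * \<epsilon> * \<kappa>) * m y K) \<le> m S (Suc K)" for K
    unfolding m_def[of S]
  proof (rule LIMSEQ_le_const[OF expectation_grid_time_tendsto[OF \<epsilon>]], intro exI allI impI)
    fix n :: nat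
    define s where "s = \<epsilon> / real (Suc n)"
    have s: "0 \<le> s" "real (Suc n) * s = \<epsilon>" using \<epsilon> by (simp_all add: s_def del: of_nat_Suc)
    have grid: "m y k \<le> law.expectation y (grid_time s (k * Suc n))" for y k
      unfolding m_def
    proof (rule integral_mono[OF min_integrable grid_time_integrable])
      show "min (T \<omega>) (real k * \<epsilon>) \<le> grid_time s (k * Suc n) \<omega>" for \<omega>
        using min_T_le_grid_time[OF s(1), of \<omega> "k * Suc n"] unfolding s_def grid_end .
    qed (rule s)
    have "(trans_prob \<epsilon> S y - C * \<epsilon> * \<kappa>) * m y K \<le>
        killed_prob s (Suc n) S y * law.expectation y (grid_time s (K * Suc n))" for y
    \<comment> \<open>\<open>killed_prob_lower\<close> speaks of states outside \<open>A\<close>; on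
      \<open>A\<close> both sides are 0.\<close>
    proof (cases "y \<in> A")
      case False
      have "(trans_prob \<epsilon> S y - C * \<epsilon> * \<kappa>) * m y K \<le> killed_prob s (Suc n) S y * m y K"
        unfolding \<kappa>_def using s False m_nonneg C by (intro mult_right_mono killed_prob_lower) auto
      also have "\<dots> \<le> killed_prob s (Suc n) S y * law.expectation y (grid_time s (K * Suc n))"
        by (intro mult_left_mono grid killed_prob_nonneg)
      finally show ?thesis .
    qed (simp add: m_target killed_prob_target)
    then have "\<epsilon> * (1 - \<kappa>) + (\<Sum>y\<in>UNIV. (trans_prob \<epsilon> S y - C * \<epsilon> * \<kappa>) * m y K) \<le>
        law.expectation S (grid_time s (Suc n)) +
        (\<Sum>y\<in>UNIV. killed_prob s (Suc n) S y * law.expectation y (grid_time s (K * Suc n)))"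
      using first grid[of S 1] by (intro add_mono sum_mono) auto
    also have "\<dots> = law.expectation S (grid_time s (Suc K * Suc n))"
      by (simp only: expectation_grid_time_add[OF s(1), symmetric] mult_Suc)
    finally show "\<epsilon> * (1 - \<kappa>) + (\<Sum>y\<in>UNIV. (trans_prob \<epsilon> S y - C * \<epsilon> * \<kappa>) * m y K) \<le>
        law.expectation S (grid_time (\<epsilon> / real (Suc n)) (Suc K * Suc n))"
      by (simp only: s_def)
  qed
  also have "m S (Suc K) \<le> h S" for K
    unfolding m_def expectation_T[symmetric] by (intro integral_mono min_integrable T_integrable) auto
  finally have "\<epsilon> * (1 - \<kappa>) + (\<Sum>y\<in>UNIV. (trans_prob \<epsilon> S y - C * \<epsilon> * \<kappa>) * m y K) \<le> h S" for K .
  moreover have "(\<lambda>K. \<epsilon> * (1 - \<kappa>) + (\<Sum>y\<in>UNIV. (trans_prob \<epsilon> S y - C * \<epsilon> * \<kappa>) * m y K)) \<longlonglongrightarrow>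
      \<epsilon> * (1 - \<kappa>) + (\<Sum>y\<in>UNIV. (trans_prob \<epsilon> S y - C * \<epsilon> * \<kappa>) * h y)"
    unfolding m_def by (intro tendsto_intros expectation_min_T_tendsto[OF \<epsilon>])
  ultimately show ?thesis by (intro LIMSEQ_le_const2) auto
qed

text \<open>Divide \<open>mean_step\<close> by \<epsilon>: every error term carries the factor
  \<kappa>, the probability of a visit up to time \<epsilon>, which tends to 0 because
  \<open>S\<close> is off the target.\<close>

lemma generator_h:
  assumes S: "S \<notin> A"
  shows "(\<Sum>y\<in>-{S}. q S y * (h y - h S)) \<le> - 1"
proof -
  obtain C \<epsilon>\<^sub>0 where C: "0 \<le> C" "0 < \<epsilon>\<^sub>0"
      "\<And>t x y. 0 \<le> t \<Longrightarrow> t < \<epsilon>\<^sub>0 \<Longrightarrow> x \<noteq> y \<Longrightarrow> trans_prob t x y \<le> C * t"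
    using trans_prob_le_linear by blast
  define \<epsilon> where "\<epsilon> n = inverse (real (Suc n))" for n
  define \<kappa> where "\<kappa> n = \<P>(\<omega> in P S. T \<omega> \<le> \<epsilon> n)" for n
  define H where "H = (\<Sum>y\<in>UNIV. h y)"
  have \<epsilon>_pos: "0 < \<epsilon> n" for n by (simp add: \<epsilon>_def)
  have \<epsilon>_lim: "\<epsilon> \<longlonglongrightarrow> 0"
    unfolding \<epsilon>_def[abs_def] by (rule LIMSEQ_inverse_real_of_nat)
  then have "filterlim \<epsilon> (at_right 0) sequentially"
    using \<epsilon>_pos by (intro tendsto_imp_filterlim_at_right) auto
  then have "(\<lambda>n. ((\<Sum>y\<in>UNIV. trans_prob (\<epsilon> n) S y * h y) - h S) / \<epsilon> n) \<longlonglongrightarrow>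
      (\<Sum>y\<in>-{S}. q S y * (h y - h S))"
    by (rule filterlim_compose[OF generator_limit])
  moreover have "(\<lambda>n. C * \<kappa> n * H - (1 - \<kappa> n)) \<longlonglongrightarrow> C * 0 * H - (1 - 0)"
    unfolding \<kappa>_def \<epsilon>_def by (intro tendsto_intros prob_T_small S)
  moreover have "eventually (\<lambda>n. ((\<Sum>y\<in>UNIV. trans_prob (\<epsilon> n) S y * h y) - h S) / \<epsilon> n \<le>
      C * \<kappa> n * H - (1 - \<kappa> n)) sequentially"
    using order_tendstoD(2)[OF \<epsilon>_lim C(2)]
  proof eventually_elim
    case (elim n)
    have "trans_prob t x y \<le> C * \<epsilon> n" if "0 \<le> t" "t \<le> \<epsilon> n" "x \<noteq> y" for t x y
    proof -
      have "trans_prob t x y \<le> C * t" using that elim by (intro C(3)) auto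
      also have "\<dots> \<le> C * \<epsilon> n" using that C(1) by (intro mult_left_mono)
      finally show ?thesis .
    qed
    from mean_step[OF S \<epsilon>_pos this C(1)]
    have "\<epsilon> n * (1 - \<kappa> n) + (\<Sum>y\<in>UNIV. (trans_prob (\<epsilon> n) S y - C * \<epsilon> n * \<kappa> n) * h y) \<le> h S"
      by (simp add: \<kappa>_def)
    also have "(\<Sum>y\<in>UNIV. (trans_prob (\<epsilon> n) S y - C * \<epsilon> n * \<kappa> n) * h y) =
        (\<Sum>y\<in>UNIV. trans_prob (\<epsilon> n) S y * h y) - C * \<epsilon> n * \<kappa> n * H"
      by (simp add: H_def left_diff_distrib sum_subtractf sum_distrib_left)
    finally show ?case
      using \<epsilon>_pos[of n] by (simp add: field_simps)
  qed
  ultimately have "(\<Sum>y\<in>-{S}. q S y * (h y - h S)) \<le> C * 0 * H - (1 - 0)"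
    by (intro tendsto_le[OF sequentially_bot]) 
  then show ?thesis by simp
qed

section \<open>The second-moment comparison on a grid\<close>

text \<open>The killed law gives \<open>A\<close> no mass, so a one-step estimate outside
  \<open>A\<close> suffices; killing only discards nonnegative contributions of
  \<open>f\<close>.\<close>

lemma killed_prob_Suc_le:
  assumes "0 \<le> s" "\<And>y. 0 \<le> f y"
    and "\<And>z. z \<notin> A \<Longrightarrow> (\<Sum>y\<in>UNIV. trans_prob s z y * f y) \<le> f' z"
  shows "(\<Sum>y\<in>UNIV. killed_prob s (Suc j) x y * f y) \<le> (\<Sum>z\<in>UNIV. killed_prob s j x z * f' z)"
proof -
  have "(\<Sum>y\<in>UNIV. killed_prob s (Suc j) x y * f y) \<le>
      (\<Sum>y\<in>UNIV. (\<Sum>z\<in>UNIV. killed_prob s j x z * trans_prob s z y) * f y)"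
    using assms by (intro sum_mono mult_right_mono)
      (auto simp: killed_prob_Suc intro!: sum_nonneg mult_nonneg_nonneg killed_prob_nonneg trans_prob_nonneg)
  also have "\<dots> = (\<Sum>z\<in>UNIV. killed_prob s j x z * (\<Sum>y\<in>UNIV. trans_prob s z y * f y))"
    unfolding sum_distrib_right sum_distrib_left by (subst sum.swap) (simp add: mult.assoc)
  also have "\<dots> \<le> (\<Sum>z\<in>UNIV. killed_prob s j x z * f' z)"
  proof (rule sum_mono)
    fix z show "killed_prob s j x z * (\<Sum>y\<in>UNIV. trans_prob s z y * f y) \<le> killed_prob s j x z * f' z"
      using assms(3)[of z]
      by (cases "z \<in> A") (auto simp: killed_prob_target intro: mult_left_mono killed_prob_nonneg)
  qed
  finally show ?thesis .
qed

text \<open>If \<open>N\<close> of the indices survive, they are the first \<open>N\<close> ones by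
  antitonicity, and the square of \<open>N\<close> is the sum of the first \<open>N\<close> odd
  numbers.\<close>

lemma grid_time_square:
  "(grid_time s k \<omega>)\<^sup>2 = s\<^sup>2 * (\<Sum>j<k. (2 * real j + 1) * of_bool (avoids s j \<omega>))"
proof -
  have "(\<Sum>j<k. of_bool (avoids s j \<omega>))\<^sup>2 = (\<Sum>j<k. (2 * real j + 1) * of_bool (avoids s j \<omega>))"
  proof (induction k)
    case (Suc k)
    have "(\<Sum>j<k. of_bool (avoids s j \<omega>)) = real k" if "avoids s k \<omega>"
    proof -
      have "avoids s j \<omega>" if "j < k" for j
        using \<open>avoids s k \<omega>\<close> that by (auto simp: avoids_def)
      then show ?thesis by simp
    qed
    with Suc show ?case
      by (cases "avoids s k \<omega>") (simp_all add: power2_sum del: sum_of_bool_eq)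
  qed simp
  then show ?thesis by (simp add: grid_time_def power_mult_distrib del: sum_of_bool_eq)
qed

text \<open>
  With \<open>b\<^sub>j\<close>, \<open>v\<^sub>j\<close>, \<open>u\<^sub>j\<close> the integrals of \<open>1\<close>, \<open>f\<close>, \<open>g\<close> against the killed law after \<open>j\<close> steps,
  \<open>(\<Sum>i<j. s\<^sup>2 (2i + 1) b\<^sub>i) + 2 j s v\<^sub>j + u\<^sub>j\<close> is nonincreasing in \<open>j\<close>.
\<close>

lemma expectation_grid_time_square_le:
  assumes s: "0 \<le> s" and nonneg: "\<And>y. 0 \<le> f y" "\<And>y. 0 \<le> g y"
    and f: "\<And>z. z \<notin> A \<Longrightarrow> (\<Sum>y\<in>UNIV. trans_prob s z y * f y) \<le> f z - s"
    and g: "\<And>z. z \<notin> A \<Longrightarrow> (\<Sum>y\<in>UNIV. trans_prob s z y * g y) \<le> g z - 2 * s * f z"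
  shows "law.expectation x (\<lambda>\<omega>. (grid_time s k \<omega>)\<^sup>2) \<le> g x"
proof -
  define b where "b j = (\<Sum>y\<in>UNIV. killed_prob s j x y)" for j
  define v where "v j = (\<Sum>y\<in>UNIV. killed_prob s j x y * f y)" for j
  define u where "u j = (\<Sum>y\<in>UNIV. killed_prob s j x y * g y)" for j
  define \<Phi> where "\<Phi> j = (\<Sum>i<j. s\<^sup>2 * ((2 * real i + 1) * b i)) + 2 * real j * s * v j + u j" for j
  have b_nonneg: "0 \<le> b j" and v_nonneg: "0 \<le> v j" and u_nonneg: "0 \<le> u j" for j
    unfolding b_def v_def u_def by (auto intro!: sum_nonneg mult_nonneg_nonneg killed_prob_nonneg nonneg)
  have v: "v (Suc j) \<le> v j - s * b j" for j
    using killed_prob_Suc_le[OF s nonneg(1) f, of j x]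
    by (simp add: v_def b_def right_diff_distrib sum_subtractf mult.commute[of s] flip: sum_distrib_right)
  have u: "u (Suc j) \<le> u j - 2 * s * v j" for j
    using killed_prob_Suc_le[OF s nonneg(2) g, of j x]
    by (simp add: u_def v_def right_diff_distrib sum_subtractf sum_distrib_left mult_ac)
  have step: "\<Phi> (Suc j) \<le> \<Phi> j" for j
  proof -
    \<comment> \<open>The drop of \<open>v\<close> gains
      \<open>2 * (j + 1) * s\<^sup>2 * b j\<close> against the new summand
      \<open>(2 * j + 1) * s\<^sup>2 * b j\<close>, a surplus of \<open>s\<^sup>2 * b j\<close>. The
      increase \<open>2 * s * v j\<close> due to the larger weight is paid for by the drop of
      \<open>u\<close>.\<close>
    have "2 * real (Suc j) * s * v (Suc j) \<le> 2 * real (Suc j) * s * (v j - s * b j)"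
      using s v by (intro mult_left_mono) auto
    moreover have "0 \<le> s\<^sup>2 * b j" using b_nonneg by simp
    ultimately show ?thesis
      using u[of j] by (simp add: \<Phi>_def algebra_simps power2_eq_square)
  qed
  have "law.expectation x (\<lambda>\<omega>. (grid_time s k \<omega>)\<^sup>2) = (\<Sum>i<k. s\<^sup>2 * ((2 * real i + 1) * b i))"
    unfolding grid_time_square using expectation_avoids[OF s]
    by (simp add: b_def sum_distrib_left del: sum_mult_of_bool_eq sum_of_bool_mult_eq)
  also have "\<dots> \<le> \<Phi> k"
    using s v_nonneg u_nonneg by (simp add: \<Phi>_def)
  also have "\<Phi> k \<le> \<Phi> 0"
    by (rule lift_Suc_antimono_le[where f = \<Phi>, OF step]) simp
  also have "\<Phi> 0 = (\<Sum>y\<in>UNIV. killed_prob s 0 x y * g y)"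
    by (simp add: \<Phi>_def u_def)
  \<comment> \<open>An inequality, since a start inside \<open>A\<close> is killed at once.\<close>
  also have "\<dots> \<le> (\<Sum>y\<in>UNIV. if y = x then g y else 0)"
    using nonneg by (intro sum_mono) (auto simp: killed_prob_0)
  also have "\<dots> = g x" by simp
  finally show ?thesis .
qed

text \<open>
  On non-target states \<open>g = c h\<^sup>2 + (c \<delta> + \<eta>) h\<close> satisfies \<open>L g \<le> (2 c h + \<eta>) L h\<close> for the generator \<open>L\<close>;
  the slack in \<open>c = 1 + \<eta> > 1\<close> absorbs the error of passing from \<open>L\<close> to a small time step.
\<close>

lemma second_moment_slack:
  assumes \<delta>: "\<And>x y. x \<noteq> y \<Longrightarrow> 0 < q x y \<Longrightarrow> h y \<le> h x \<and> h x - h y \<le> \<delta>" "0 \<le> \<delta>"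
    and \<eta>: "0 < \<eta>"
  shows "(\<integral>\<^sup>+\<omega>. ennreal ((T \<omega>)\<^sup>2) \<partial>P S) \<le> ennreal ((1 + \<eta>) * (h S)\<^sup>2 + ((1 + \<eta>) * \<delta> + \<eta>) * h S)"
proof -
  define c where "c = 1 + \<eta>"
  define f where "f y = c * h y" for y
  define g where "g y = c * (h y)\<^sup>2 + (c * \<delta> + \<eta>) * h y" for y
  have c: "1 < c" using \<eta> by (simp add: c_def)
  have f_nonneg: "0 \<le> f y" and g_nonneg: "0 \<le> g y" for y
    using c \<eta> \<delta>(2) h_nonneg[of y] by (simp_all add: f_def g_def)
  have Lf: "(\<Sum>y\<in>-{x}. q x y * (f y - f x)) < - 1" if "x \<notin> A" for x
  proof -
    have "(\<Sum>y\<in>-{x}. q x y * (f y - f x)) = c * (\<Sum>y\<in>-{x}. q x y * (h y - h x))"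
      unfolding sum_distrib_left f_def by (intro sum.cong) (auto simp: algebra_simps)
    also have "\<dots> \<le> c * - 1" using generator_h[OF that] c by (intro mult_left_mono) auto
    finally show ?thesis using c by simp
  qed
  have Lg: "(\<Sum>y\<in>-{x}. q x y * (g y - g x)) < - (2 * f x)" if "x \<notin> A" for x
  proof -
    have "q x y * (g y - g x) \<le> (2 * f x + \<eta>) * (q x y * (h y - h x))" if "x \<noteq> y" for y
    proof (cases "0 < q x y")
      case True
      \<comment> \<open>Monotonicity makes \<open>h x - h y\<close> nonnegative, so its square is at
        most \<delta> times itself. The term \<open>c * \<delta> * h\<close> in \<open>g\<close>
        absorbs exactly this quadratic part of \<open>g y - g x\<close>.\<close>
      with \<delta>(1)[of x y] that have "(h x - h y) * (h x - h y) \<le> \<delta> * (h x - h y)"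
        by (intro mult_right_mono) auto
      then have "c * ((h x - h y) * (h x - h y)) \<le> c * (\<delta> * (h x - h y))"
        using c by (intro mult_left_mono) auto
      then have "g y - g x \<le> (2 * f x + \<eta>) * (h y - h x)"
        by (simp add: f_def g_def power2_eq_square algebra_simps)
      then have "q x y * (g y - g x) \<le> q x y * ((2 * f x + \<eta>) * (h y - h x))"
        using True by (intro mult_left_mono) auto
      then show ?thesis by (simp add: mult_ac)
    next
      case False
      with rate_nonneg[of x y] that show ?thesis by simp
    qed
    then have "(\<Sum>y\<in>-{x}. q x y * (g y - g x)) \<le> (2 * f x + \<eta>) * (\<Sum>y\<in>-{x}. q x y * (h y - h x))"
      unfolding sum_distrib_left by (intro sum_mono) auto
    also have "\<dots> \<le> (2 * f x + \<eta>) * - 1"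
      using generator_h[OF that] f_nonneg \<eta> by (intro mult_left_mono) auto
    finally show ?thesis using \<eta> by simp
  qed
  \<comment> \<open>Strictness of both generator bounds lets them pass to a positive time step,
    which the finitely many states share. The mesh is then kept fixed, and only the horizon
    grows.\<close>
  have "eventually (\<lambda>t. x \<notin> A \<longrightarrow>
      ((\<Sum>y\<in>UNIV. trans_prob t x y * f y) - f x) / t < - 1 \<and>
      ((\<Sum>y\<in>UNIV. trans_prob t x y * g y) - g x) / t < - (2 * f x)) (at_right 0)" for x
  proof (cases "x \<in> A")
    case False
    then show ?thesis
      using order_tendstoD(2)[OF generator_limit Lf[OF False]]
        order_tendstoD(2)[OF generator_limit Lg[OF False]]
      by eventually_elim simp
  qed simp
  then have "eventually (\<lambda>t. \<forall>x. x \<notin> A \<longrightarrow>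
      ((\<Sum>y\<in>UNIV. trans_prob t x y * f y) - f x) / t < - 1 \<and>
      ((\<Sum>y\<in>UNIV. trans_prob t x y * g y) - g x) / t < - (2 * f x)) (at_right 0)"
    by (rule eventually_all_finite)
  then obtain b where b: "0 < b" "\<And>t x. 0 < t \<Longrightarrow> t < b \<Longrightarrow> x \<notin> A \<Longrightarrow>
      ((\<Sum>y\<in>UNIV. trans_prob t x y * f y) - f x) / t < - 1 \<and>
      ((\<Sum>y\<in>UNIV. trans_prob t x y * g y) - g x) / t < - (2 * f x)"
    unfolding eventually_at_right_field by auto
  define s where "s = b / 2"
  have s: "0 < s" using b(1) by (simp add: s_def)
  have pf: "(\<Sum>y\<in>UNIV. trans_prob s x y * f y) \<le> f x - s"
    and pg: "(\<Sum>y\<in>UNIV. trans_prob s x y * g y) \<le> g x - 2 * s * f x" if "x \<notin> A" for x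
    using b(2)[of s x] b(1) s that by (simp_all add: s_def field_simps)
  have bound: "(\<integral>\<^sup>+\<omega>. ennreal ((min (T \<omega>) (real k * s))\<^sup>2) \<partial>P S) \<le> ennreal (g S)" for k
  proof -
    have int: "integrable (P S) (\<lambda>\<omega>. (grid_time s k \<omega>)\<^sup>2)"
      unfolding grid_time_square using s
      by (intro integrable_mult_right Bochner_Integration.integrable_sum expectation_avoids) auto
    have "(\<integral>\<^sup>+\<omega>. ennreal ((min (T \<omega>) (real k * s))\<^sup>2) \<partial>P S) \<le>
        (\<integral>\<^sup>+\<omega>. ennreal ((grid_time s k \<omega>)\<^sup>2) \<partial>P S)"
      using s T_nonneg by (intro nn_integral_mono ennreal_leI power_mono min_T_le_grid_time) auto
    also have "\<dots> = ennreal (law.expectation S (\<lambda>\<omega>. (grid_time s k \<omega>)\<^sup>2))"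
      using int by (intro nn_integral_eq_integral) auto
    also have "\<dots> \<le> ennreal (g S)"
      using s by (intro ennreal_leI expectation_grid_time_square_le[where f = f] f_nonneg g_nonneg pf pg) auto
    finally show ?thesis .
  qed
  have "(\<lambda>k. ennreal ((min (T \<omega>) (real k * s))\<^sup>2)) \<longlonglongrightarrow> ennreal ((T \<omega>)\<^sup>2)" for \<omega>
  proof (rule tendsto_eventually)
    have "filterlim (\<lambda>k. real k * s) at_top sequentially" using s by real_asymp
    then have "eventually (\<lambda>k. T \<omega> \<le> real k * s) sequentially"
      by (simp add: filterlim_at_top)
    then show "eventually (\<lambda>k. ennreal ((min (T \<omega>) (real k * s))\<^sup>2) = ennreal ((T \<omega>)\<^sup>2)) sequentially"
      by eventually_elim (simp add: min_absorb1)
  qed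
  \<comment> \<open>Fatou's lemma applies, since on each path the truncations are eventually equal
    to \<open>T \<omega>\<close>.\<close>
  then have "(\<integral>\<^sup>+\<omega>. ennreal ((T \<omega>)\<^sup>2) \<partial>P S) =
      (\<integral>\<^sup>+\<omega>. liminf (\<lambda>k. ennreal ((min (T \<omega>) (real k * s))\<^sup>2)) \<partial>P S)"
    by (intro nn_integral_cong) (metis lim_imp_Liminf sequentially_bot)
  also have "\<dots> \<le> liminf (\<lambda>k. \<integral>\<^sup>+\<omega>. ennreal ((min (T \<omega>) (real k * s))\<^sup>2) \<partial>P S)"
    by (rule nn_integral_liminf) measurable
  also have "\<dots> \<le> ennreal (g S)"
    by (rule order_trans[OF Liminf_le_Limsup Limsup_bounded]) (auto simp: bound)
  finally show ?thesis by (simp add: g_def c_def)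
qed

text \<open>The instance of \<open>second_moment_slack\<close> with slack 1 gives integrability;
  afterwards the slack tends to 0.\<close>

lemma second_moment:
  assumes \<delta>: "\<And>x y. x \<noteq> y \<Longrightarrow> 0 < q x y \<Longrightarrow> h y \<le> h x \<and> h x - h y \<le> \<delta>" "0 \<le> \<delta>"
  shows "integrable (P S) (\<lambda>\<omega>. (T \<omega>)\<^sup>2)"
    and "law.expectation S (\<lambda>\<omega>. (T \<omega>)\<^sup>2) \<le> (h S)\<^sup>2 + \<delta> * h S"
proof -
  have "(\<integral>\<^sup>+\<omega>. ennreal ((T \<omega>)\<^sup>2) \<partial>P S) < \<infinity>"
    using second_moment_slack[OF \<delta>, of 1 S] by (rule le_less_trans) auto
  then show int: "integrable (P S) (\<lambda>\<omega>. (T \<omega>)\<^sup>2)"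
    by (intro integrableI_nonneg) auto
  have "law.expectation S (\<lambda>\<omega>. (T \<omega>)\<^sup>2) \<le> (1 + \<eta>) * (h S)\<^sup>2 + ((1 + \<eta>) * \<delta> + \<eta>) * h S"
    if "0 < \<eta>" for \<eta>
  proof -
    have "ennreal (law.expectation S (\<lambda>\<omega>. (T \<omega>)\<^sup>2)) = (\<integral>\<^sup>+\<omega>. ennreal ((T \<omega>)\<^sup>2) \<partial>P S)"
      using int by (intro nn_integral_eq_integral[symmetric]) auto
    also have "\<dots> \<le> ennreal ((1 + \<eta>) * (h S)\<^sup>2 + ((1 + \<eta>) * \<delta> + \<eta>) * h S)"
      using \<delta> that by (rule second_moment_slack)
    finally show ?thesis
      using that \<delta>(2) h_nonneg[of S] by (subst (asm) ennreal_le_iff) auto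
  qed
  then have "eventually (\<lambda>\<eta>. law.expectation S (\<lambda>\<omega>. (T \<omega>)\<^sup>2) \<le>
      (1 + \<eta>) * (h S)\<^sup>2 + ((1 + \<eta>) * \<delta> + \<eta>) * h S) (at_right 0)"
    by (intro eventually_at_rightI[of 0 1]) auto
  moreover have "((\<lambda>\<eta>. (1 + \<eta>) * (h S)\<^sup>2 + ((1 + \<eta>) * \<delta> + \<eta>) * h S) \<longlongrightarrow>
      (1 + 0) * (h S)\<^sup>2 + ((1 + 0) * \<delta> + 0) * h S) (at_right 0)"
    by (intro tendsto_intros)
  ultimately have "law.expectation S (\<lambda>\<omega>. (T \<omega>)\<^sup>2) \<le> (1 + 0) * (h S)\<^sup>2 + ((1 + 0) * \<delta> + 0) * h S"
    by (intro tendsto_lowerbound) auto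
  then show "law.expectation S (\<lambda>\<omega>. (T \<omega>)\<^sup>2) \<le> (h S)\<^sup>2 + \<delta> * h S" by simp
qed

section \<open>From the second moment to the variance bound\<close>

text \<open>If all rates out of \<open>S\<close> vanished, so would the generator sum, against
  \<open>generator_h\<close>. Hence the maximum in the theorem is over a nonempty set.\<close>

lemma possible_transition_exists:
  assumes "S \<notin> A"
  shows "\<exists>y. possible_transition q S y"
proof (rule ccontr)
  assume "\<not> ?thesis"
  then have "q S y = 0" if "y \<noteq> S" for y
    using rate_nonneg[of S y] that by (force simp: possible_transition_def)
  then have "(\<Sum>y\<in>-{S}. q S y * (h y - h S)) = 0" by (intro sum.neutral) auto
  with generator_h[OF assms] show False by simp
qed

end

theorem lemma1:
  fixes P :: "'s::finite \<Rightarrow> 'w measure"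
    and Z :: "real \<Rightarrow> 'w \<Rightarrow> 's"
    and q :: "'s \<Rightarrow> 's \<Rightarrow> real"
    and \<Sigma>\<^sub>0 :: "'s set"
    and S\<^sub>0 :: 's
  assumes "finite_ctmc P Z q"
    and "\<And>S. mean_hitting_time P Z \<Sigma>\<^sub>0 S < \<infinity>"
    and "\<And>S S'. possible_transition q S S' \<Longrightarrow>
           mean_hitting_time P Z \<Sigma>\<^sub>0 S' \<le> mean_hitting_time P Z \<Sigma>\<^sub>0 S"
    and "S\<^sub>0 \<notin> \<Sigma>\<^sub>0"
  shows "integrable (P S\<^sub>0) (\<lambda>\<omega>. (real_hitting_time Z \<Sigma>\<^sub>0 \<omega>)\<^sup>2) \<and>
    prob_space.variance (P S\<^sub>0) (real_hitting_time Z \<Sigma>\<^sub>0)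
      / prob_space.expectation (P S\<^sub>0) (real_hitting_time Z \<Sigma>\<^sub>0)
    \<le> Max {enn2real (mean_hitting_time P Z \<Sigma>\<^sub>0 S) - enn2real (mean_hitting_time P Z \<Sigma>\<^sub>0 S')
           | S S'. possible_transition q S S'}"
proof -
  interpret finite_ctmc_hitting P Z q \<Sigma>\<^sub>0
    using assms(1,2) by (simp add: finite_ctmc_hitting_def finite_ctmc_hitting_axioms_def)
  define D where "D = {h S - h S' | S S'. possible_transition q S S'}"
  define \<delta> where "\<delta> = Max D"
  have "D \<subseteq> (\<lambda>(S, S'). h S - h S') ` UNIV" by (auto simp: D_def)
  then have "finite D" by (rule finite_subset) simp
  then have le_\<delta>: "h x - h y \<le> \<delta>" if "possible_transition q x y" for x y
    using that by (auto simp: \<delta>_def D_def intro!: Max_ge)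
  have mono: "h y \<le> h x" if "possible_transition q x y" for x y
    unfolding h_def using assms(2) assms(3)[OF that] by (intro enn2real_mono) auto
  obtain y where "possible_transition q S\<^sub>0 y"
    using possible_transition_exists[OF assms(4)] by blast
  \<comment> \<open>Some transition leaves \<open>S\<^sub>0\<close> and does not increase
    \<open>h\<close>; its decrease is nonnegative and at most \<delta>.\<close>
  then have "0 \<le> \<delta>" using le_\<delta> mono by fastforce
  have \<delta>: "h y \<le> h x \<and> h x - h y \<le> \<delta>" if "x \<noteq> y" "0 < q x y" for x y
    using le_\<delta>[of x y] mono[of x y] that by (simp add: possible_transition_def)
  note moment = second_moment[OF \<delta> \<open>0 \<le> \<delta>\<close>, of S\<^sub>0]
  have "law.variance S\<^sub>0 T = law.expectation S\<^sub>0 (\<lambda>\<omega>. (T \<omega>)\<^sup>2) - (h S\<^sub>0)\<^sup>2"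
    using law.variance_eq[OF T_integrable moment(1)] by (simp add: expectation_T)
  with moment(2) have "law.variance S\<^sub>0 T \<le> \<delta> * h S\<^sub>0" by simp
  then have "law.variance S\<^sub>0 T / h S\<^sub>0 \<le> \<delta>"
    \<comment> \<open>If \<open>h S\<^sub>0 = 0\<close>, the quotient is 0 by the convention for
      division by zero.\<close>
    using \<open>0 \<le> \<delta>\<close> h_nonneg[of S\<^sub>0] by (cases "h S\<^sub>0 = 0") (simp_all add: field_simps)
  with moment(1) show ?thesis
    by (simp add: expectation_T \<delta>_def D_def h_def)
qed

end
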